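(* For each integer $s\ge2$ let $n=s^{s+1}$ and let $L^{(s)}$ be the balanced necklace with $2n$ beads ($n$ red, $n$ blue) given by the Construction described in the context. Then, as $s\to\infty$, the maximum size (number of matched pairs) of a proper matching of $L^{(s)}$ is at most $\frac{2n}{3}+o(n)$, both in the heterogeneous model and in the homogeneous model.
   Context: A necklace is a cyclic sequence of beads, each colored red or blue; it is balanced if it has $n$ red and $n$ blue beads. A matching is a set of mutually disjoint pairs (edges) of beads; its size is its number of edges. In the heterogeneous model each pair consists of one red and one blue bead; in the homogeneous model each pair consists of two beads of the same color. A matching is cross-free if for any two of its edges $ab$ and $cd$, one of the two arcs between $a$ and $b$ is disjoint from $\{c,d\}$ while the other arc contains $\{c,d\}$. A secant partitions the necklace into two contiguous arcs $A_1,A_2$; a matching is secant-respecting (for that secant) if every edge has one end in $A_1$ and the other in $A_2$. A matching is proper if it is cross-free and secant-respecting for some secant. Construction. Let $s\ge2$ be an integer and $n=s^{s+1}$. The necklace consists of $s$ consecutive large arcs $L_1,\dots,L_s$, each with $s^s$ blue and $s^s$ red beads. The large arc $L_i$ is divided into $2s^{s-i}$ consecutive monochromatic arcs, each consisting of $s^i$ beads, with alternating colors ($s^{s-i}$ red and $s^{s-i}$ blue arcs); all the $L_i$ start with the same color, so that colors of consecutive arcs alternate along the whole necklace. *)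

theory Defs
  imports Complex_Main "HOL-Library.Disjoint_Sets" "HOL-Library.Landau_Symbols"
begin

datatype color = Red | Blue

fun opposite :: "color \<Rightarrow> color" where
  "opposite Red = Blue"
| "opposite Blue = Red"

text \<open>A necklace is a list read cyclically; its beads are the positions of the list.\<close>

type_synonym necklace = "color list"

definition beads :: "necklace \<Rightarrow> nat set" where
  "beads N = {..<length N}"

definition balanced :: "nat \<Rightarrow> necklace \<Rightarrow> bool" where
  "balanced n N \<longleftrightarrow> count_list N Red = n \<and> count_list N Blue = n"

definition matching :: "necklace \<Rightarrow> nat set set \<Rightarrow> bool" where
  "matching N M \<longleftrightarrow> (\<forall>e\<in>M. e \<subseteq> beads N \<and> card e = 2) \<and> disjoint M"

datatype model = Heterogeneous | Homogeneous

fun pair_allowed :: "model \<Rightarrow> color \<Rightarrow> color \<Rightarrow> bool" where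
  "pair_allowed Heterogeneous x y \<longleftrightarrow> x \<noteq> y"
| "pair_allowed Homogeneous x y \<longleftrightarrow> x = y"

definition model_matching :: "model \<Rightarrow> necklace \<Rightarrow> nat set set \<Rightarrow> bool" where
  "model_matching m N M \<longleftrightarrow>
     matching N M \<and> (\<forall>a b. {a, b} \<in> M \<longrightarrow> pair_allowed m (N ! a) (N ! b))"

text \<open>The beads met strictly after \<open>a\<close> and strictly before \<open>b\<close> when walking around the
  necklace in increasing direction. For distinct beads \<open>a\<close> and \<open>b\<close>, the two arcs between them
  are \<open>arc_between N a b\<close> and \<open>arc_between N b a\<close>.\<close>

definition arc_between :: "necklace \<Rightarrow> nat \<Rightarrow> nat \<Rightarrow> nat set" where
  "arc_between N a b =
     (if a < b then {a<..<b} else {a<..<length N} \<union> {..<b})"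

definition cross_free :: "necklace \<Rightarrow> nat set set \<Rightarrow> bool" where
  "cross_free N M \<longleftrightarrow>
     (\<forall>a b c d. {a, b} \<in> M \<longrightarrow> {c, d} \<in> M \<longrightarrow> {a, b} \<noteq> {c, d} \<longrightarrow>
        (arc_between N a b \<inter> {c, d} = {} \<and> {c, d} \<subseteq> arc_between N b a) \<or>
        (arc_between N b a \<inter> {c, d} = {} \<and> {c, d} \<subseteq> arc_between N a b))"

definition contiguous_arc :: "necklace \<Rightarrow> nat set \<Rightarrow> bool" where
  "contiguous_arc N A \<longleftrightarrow>
     (\<exists>i l. 0 < l \<and> l \<le> length N \<and> A = (\<lambda>k. (i + k) mod length N) ` {..<l})"

definition secant :: "necklace \<Rightarrow> nat set \<Rightarrow> nat set \<Rightarrow> bool" where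
  "secant N A\<^sub>1 A\<^sub>2 \<longleftrightarrow>
     contiguous_arc N A\<^sub>1 \<and> contiguous_arc N A\<^sub>2 \<and> A\<^sub>1 \<union> A\<^sub>2 = beads N \<and> A\<^sub>1 \<inter> A\<^sub>2 = {}"

definition secant_respecting :: "nat set \<Rightarrow> nat set \<Rightarrow> nat set set \<Rightarrow> bool" where
  "secant_respecting A\<^sub>1 A\<^sub>2 M \<longleftrightarrow> (\<forall>e\<in>M. \<exists>a\<in>A\<^sub>1. \<exists>b\<in>A\<^sub>2. e = {a, b})"

definition proper :: "necklace \<Rightarrow> nat set set \<Rightarrow> bool" where
  "proper N M \<longleftrightarrow>
     cross_free N M \<and> (\<exists>A\<^sub>1 A\<^sub>2. secant N A\<^sub>1 A\<^sub>2 \<and> secant_respecting A\<^sub>1 A\<^sub>2 M)"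

definition max_proper :: "model \<Rightarrow> necklace \<Rightarrow> nat" where
  "max_proper m N = Max {card M | M. model_matching m N M \<and> proper N M}"

definition large_arc :: "color \<Rightarrow> nat \<Rightarrow> nat \<Rightarrow> color list" where
  "large_arc c s i =
     concat (map (\<lambda>j. replicate (s ^ i) (if even j then c else opposite c))
                 [0..<2 * s ^ (s - i)])"

text \<open>The color \<open>c\<close> of the first bead of every large arc is left open by the construction.\<close>

definition L_necklace :: "color \<Rightarrow> nat \<Rightarrow> necklace" where
  "L_necklace c s = concat (map (large_arc c s) [1..<Suc s])"

lemma count_alternating:
  "count_list (concat (map (\<lambda>j. replicate k (if even j then c else opposite c)) [0..<2 * m])) x
     = m * k"
proof (induction m)
  case (Suc m)
  have rep: "count_list (replicate k y) z = (if y = z then k else 0)" for y z :: color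
    by (induction k) auto
  show ?case
    using Suc by (cases c; cases x) (auto simp: rep)
qed simp

lemma balanced_L_necklace: "balanced (s ^ (s + 1)) (L_necklace c s)"
proof -
  have "count_list (L_necklace c s) x = s ^ (s + 1)" for x
  proof -
    have arc: "count_list (large_arc c s i) x = s ^ s" if "i \<in> set [1..<Suc s]" for i
      using that by (auto simp: large_arc_def count_alternating simp flip: power_add)
    have concat_arcs: "count_list (concat (map f xs)) x = length xs * q"
      if "\<And>i. i \<in> set xs \<Longrightarrow> count_list (f i) x = q" for f :: "nat \<Rightarrow> necklace" and xs q
      using that by (induction xs) auto
    show ?thesis
      using concat_arcs[of "[1..<Suc s]" "large_arc c s", OF arc]
      by (simp add: L_necklace_def del: upt_Suc)
  qed
  then show ?thesis by (simp add: balanced_def)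
qed

lemma length_L_necklace: "length (L_necklace c s) = 2 * s ^ (s + 1)"
proof -
  have "length N = count_list N Red + count_list N Blue" for N
  proof (induction N)
    case (Cons x N)
    then show ?case by (cases x) auto
  qed simp
  then show ?thesis
    using balanced_L_necklace[of s c] by (simp add: balanced_def)
qed

text \<open>The maximum in \<open>max_proper\<close> is over a finite set, which is nonempty as soon as the
  necklace admits a secant.\<close>

lemma finite_proper_sizes: "finite {card M | M. model_matching m N M \<and> proper N M}"
proof -
  have "{M. model_matching m N M \<and> proper N M} \<subseteq> Pow (Pow (beads N))"
    by (auto simp: model_matching_def matching_def)
  then have "finite {M. model_matching m N M \<and> proper N M}"
    by (rule finite_subset) (simp add: beads_def)
  then show ?thesis by simp
qed

lemma proper_sizes_nonempty:
  assumes "2 \<le> length N"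
  shows "{card M | M. model_matching m N M \<and> proper N M} \<noteq> {}"
proof -
  let ?n = "length N"
  have "contiguous_arc N {0}"
    unfolding contiguous_arc_def using assms by (intro exI[of _ 0] exI[of _ 1]) auto
  moreover have "contiguous_arc N {1..<?n}"
  proof -
    have "(\<lambda>k. (1 + k) mod ?n) ` {..<?n - 1} = (\<lambda>k. 1 + k) ` {..<?n - 1}"
      by (rule image_cong) auto
    also have "\<dots> = {1..<?n}"
    proof -
      have "x \<in> (\<lambda>k. 1 + k) ` {..<?n - 1}" if "x \<in> {1..<?n}" for x
        using that by (intro image_eqI[of _ _ "x - 1"]) auto
      then show ?thesis by auto
    qed
    finally show ?thesis
      unfolding contiguous_arc_def using assms by (intro exI[of _ 1] exI[of _ "?n - 1"]) auto
  qed
  ultimately have "secant N {0} {1..<?n}"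
    using assms by (auto simp: secant_def beads_def)
  then have "proper N {}"
    unfolding proper_def cross_free_def secant_respecting_def by blast
  moreover have "model_matching m N {}"
    by (simp add: model_matching_def matching_def)
  ultimately show ?thesis by blast
qed

end

theory Submission
  imports Defs
begin

text \<open>An edge whose ends lie in the same large arc must be separated by the secant, so it lies
  in one of at most two large arcs; such edges number \<open>O(s ^ s) = o(n)\<close>. Any other edge has a fine
  end \<open>x\<close> in some \<open>L\<^sub>i\<close> and a coarse end \<open>y\<close> in some \<open>L\<^sub>j\<close>, \<open>i < j\<close>. Group these edges by \<open>i\<close> and the
  monochromatic block of \<open>y\<close>. The fine ends within a group have the same color, and by
  cross-freeness no bead lying between them is matched outside the group, so \<open>x - s ^ i\<close>, having the other
  color, is unmatched unless \<open>x\<close> is among the first \<open>s ^ i\<close> beads of the span of its group.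
  Since \<open>\<Sum>\<^bsub>i<j\<^esub> s ^ i\<close> is small compared to the length \<open>s ^ j\<close> of the coarse block, there are only
  \<open>O(s ^ s)\<close> exceptions. Hence an edge costs on average three beads: its ends and an unmatched bead.\<close>

section \<open>Colors of the beads\<close>

lemma concat_uniform:
  assumes "\<And>i. i < m \<Longrightarrow> length (f i) = k"
  shows length_concat_uniform: "length (concat (map f [0..<m])) = m * k"
    and nth_concat_uniform:
      "x < m * k \<Longrightarrow> concat (map f [0..<m]) ! x = f (x div k) ! (x mod k)"
proof -
  have len: "length (concat (map f [0..<m'])) = m' * k" if "m' \<le> m" for m'
    using that assms by (induction m') auto
  then show "length (concat (map f [0..<m])) = m * k" by simp
  have "concat (map f [0..<m']) ! x = f (x div k) ! (x mod k)" if "m' \<le> m" "x < m' * k" for m' x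
    using that
  proof (induction m')
    case (Suc m')
    show ?case
    proof (cases "x < m' * k")
      case True
      then show ?thesis using Suc len[of m'] by (simp add: nth_append)
    next
      case False
      then have "x div k = m'"
        using Suc.prems by (intro div_nat_eqI) (auto simp: mult.commute)
      moreover from this have "x mod k = x - m' * k"
        by (metis minus_div_mult_eq_mod)
      ultimately show ?thesis using Suc.prems False len[of m'] by (simp add: nth_append)
    qed
  qed simp
  then show "x < m * k \<Longrightarrow> concat (map f [0..<m]) ! x = f (x div k) ! (x mod k)" by simp
qed

definition level :: "nat \<Rightarrow> nat \<Rightarrow> nat" where
  "level s x = x div (2 * s ^ s)"

text \<open>Levels count from \<open>0\<close>, so the blocks at level \<open>i\<close> consist of \<open>s ^ Suc i\<close> beads.\<close>

definition block :: "nat \<Rightarrow> nat \<Rightarrow> nat" where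
  "block s x = x div s ^ Suc (level s x)"

lemma large_arc_length:
  assumes "i \<le> s"
  shows "length (large_arc c s i) = 2 * s ^ s"
  using assms unfolding large_arc_def
  by (subst length_concat_uniform[where k = "s ^ i"]) (auto simp flip: power_add)

lemma level_less:
  assumes "x < 2 * s ^ (s + 1)"
  shows "level s x < s"
  using assms unfolding level_def by (auto simp: less_mult_imp_div_less mult.commute mult.left_commute)

text \<open>\<open>block\<close> counts from the start of the necklace, not of the large arc. The
  parities agree because every large arc consists of an even number of blocks at its own level, so
  the offset is an even number of block lengths.\<close>

lemma nth_L_necklace:
  assumes "x < 2 * s ^ (s + 1)"
  shows "L_necklace c s ! x = (if even (block s x) then c else opposite c)"
proof -
  let ?w = "2 * s ^ s"
  let ?q = "s ^ Suc (level s x)"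
  let ?t = "s ^ (s - Suc (level s x))"
  have lev: "level s x < s"
    by (rule level_less[OF assms])
  have w: "?w = ?q * (2 * ?t)"
    using lev by (simp del: power_Suc flip: power_add)
  have w0: "0 < ?w"
    using lev by simp
  have "L_necklace c s = concat (map (\<lambda>i. large_arc c s (Suc i)) [0..<s])"
    unfolding L_necklace_def by (simp only: One_nat_def map_Suc_upt[symmetric] map_map comp_def)
  then have "L_necklace c s ! x = large_arc c s (Suc (level s x)) ! (x mod ?w)"
    using assms nth_concat_uniform[of s "\<lambda>i. large_arc c s (Suc i)" ?w x]
    by (simp add: large_arc_length level_def mult.left_commute)
  also have "\<dots> = (if even (x mod ?w div ?q) then c else opposite c)"
  proof -
    have "x mod ?w < 2 * ?t * ?q"
      using w w0 by (metis mod_less_divisor mult.commute)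
    moreover have "x mod ?w mod ?q < ?q"
      using lev by (intro mod_less_divisor zero_less_power) simp
    ultimately show ?thesis
      unfolding large_arc_def by (subst nth_concat_uniform[where k = ?q]) auto
  qed
  also have "x mod ?w div ?q = block s x mod (2 * ?t)"
    using lev unfolding w block_def by (simp add: mod_mult2_eq del: power_Suc)
  finally show ?thesis
    by (simp add: even_mod_2_iff dvd_mod_iff)
qed

section \<open>Edges between different large arcs\<close>

text \<open>A pair \<open>(x, y)\<close> is an edge oriented from its fine to its coarse end;
  \<open>nested\<close> is cross-freeness read along the linear order. Colors enter only through
  \<open>parity\<close>, which both models satisfy: the color of one end of an allowed pair
  determines that of the other.\<close>

locale fine_coarse_edges =
  fixes s :: nat and E :: "(nat \<times> nat) set"
  assumes s_ge_2: "2 \<le> s"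
    and bounded: "(x, y) \<in> E \<Longrightarrow> y < 2 * s ^ (s + 1)"
    and level_fst_less_snd: "(x, y) \<in> E \<Longrightarrow> level s x < level s y"
    and ends_disjoint:
      "(x, y) \<in> E \<Longrightarrow> (x', y') \<in> E \<Longrightarrow> {x, y} \<inter> {x', y'} \<noteq> {} \<Longrightarrow> (x, y) = (x', y')"
    and nested: "(x, y) \<in> E \<Longrightarrow> (x', y') \<in> E \<Longrightarrow> x < x' \<Longrightarrow> x' < y \<Longrightarrow> y' < y"
    and parity: "(x, y) \<in> E \<Longrightarrow> (x', y') \<in> E \<Longrightarrow> even (block s y) = even (block s y') \<Longrightarrow>
      even (block s x) = even (block s x')"
begin

definition ends :: "nat set" where
  "ends = fst ` E \<union> snd ` E"

text \<open>The level of the coarse end is recorded because \<open>block\<close> numbers identify a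
  block only within a fixed level.\<close>

definition group :: "nat \<times> nat \<Rightarrow> nat \<times> nat \<times> nat" where
  "group e = (level s (fst e), level s (snd e), block s (snd e))"

definition late :: "(nat \<times> nat) set" where
  "late = {e \<in> E. \<exists>e'\<in>E. group e' = group e \<and> fst e' + s ^ Suc (level s (fst e)) \<le> fst e}"

lemma level_mono: "x \<le> y \<Longrightarrow> level s x \<le> level s y"
  by (simp add: level_def div_le_mono)

lemma fst_less_snd: "(x, y) \<in> E \<Longrightarrow> x < y"
  using level_fst_less_snd level_mono by (meson leD leI)

lemma fst_bounded: "(x, y) \<in> E \<Longrightarrow> x < 2 * s ^ (s + 1)"
  using bounded fst_less_snd less_trans by blast

lemma finite_E: "finite E"
proof (rule finite_subset)
  show "E \<subseteq> {..<2 * s ^ (s + 1)} \<times> {..<2 * s ^ (s + 1)}"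
    by (auto dest: bounded fst_bounded simp del: power_Suc power_Suc2)
qed simp

lemma inj_fst: "inj_on fst E"
  by (rule inj_onI) (metis ends_disjoint disjoint_iff insertI1 prod.collapse)

lemma inj_snd: "inj_on snd E"
  by (rule inj_onI) (metis ends_disjoint disjoint_iff insertCI prod.collapse)

lemma card_ends: "card ends = 2 * card E"
proof -
  have "x \<noteq> y'" if "(x, y) \<in> E" "(x', y') \<in> E" for x y x' y'
    using ends_disjoint[OF that] fst_less_snd[OF that(1)] by auto
  then have "fst ` E \<inter> snd ` E = {}"
    by auto
  then show ?thesis
    using finite_E by (simp add: ends_def card_Un_disjoint card_image inj_fst inj_snd)
qed

lemma ends_bounded: "ends \<subseteq> {..<2 * s ^ (s + 1)}"
  by (auto simp: ends_def simp del: power_Suc power_Suc2 dest: bounded fst_bounded)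

section \<open>Unmatched beads forced by late edges\<close>

text \<open>An edge with fine end \<open>z\<close> is nested between the two given edges, so its
  coarse end lies between \<open>y2\<close> and \<open>y1\<close>, hence in their common
  block.\<close>

lemma end_in_span:
  assumes e1: "(x1, y1) \<in> E" and e2: "(x2, y2) \<in> E"
    and grp: "group (x1, y1) = group (x2, y2)"
    and z: "x1 \<le> z" "z \<le> x2" "z \<in> ends"
  obtains y where "(z, y) \<in> E" "group (z, y) = group (x1, y1)"
proof -
  have lev: "level s z = level s x1" "level s x2 = level s x1"
    using level_mono[OF z(1)] level_mono[OF z(2)] grp by (auto simp: group_def)
  consider y where "(z, y) \<in> E" | x where "(x, z) \<in> E"
    using z(3) by (auto simp: ends_def)
  then show thesis
  proof cases
    case 1
    have "y2 \<le> y"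
    proof (cases "z = x2")
      case True
      then show ?thesis using ends_disjoint[OF e2 1] by simp
    next
      case False
      have "x2 < y"
        using level_fst_less_snd[OF 1] lev level_mono[of y x2] by (metis not_le)
      then show ?thesis using nested[OF 1 e2] False z by simp
    qed
    have "y \<le> y1"
    proof (cases "z = x1")
      case True
      then show ?thesis using ends_disjoint[OF e1 1] by simp
    next
      case False
      have "z < y1"
        using level_fst_less_snd[OF e1] lev level_mono[of y1 z] by (metis not_le)
      then show ?thesis using nested[OF e1 1] False z by simp
    qed
    have lev_y: "level s y = level s y1"
      using level_mono[OF \<open>y2 \<le> y\<close>] level_mono[OF \<open>y \<le> y1\<close>] grp by (simp add: group_def)
    have "level s y2 = level s y1" "block s y2 = block s y1"
      using grp by (simp_all add: group_def)
    then have "y2 div s ^ Suc (level s y1) = y1 div s ^ Suc (level s y1)"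
      by (simp add: block_def del: power_Suc)
    then have "y div s ^ Suc (level s y1) = y1 div s ^ Suc (level s y1)"
      using div_le_mono[OF \<open>y2 \<le> y\<close>] div_le_mono[OF \<open>y \<le> y1\<close>] by (metis antisym)
    then have "block s y = block s y1"
      by (simp only: block_def lev_y)
    then show thesis
      using that[OF 1] lev lev_y by (simp add: group_def)
  next
    \<comment> \<open>If \<open>z\<close> were a coarse end, its partner would precede
      \<open>x1\<close>; nesting would give \<open>y1 < z\<close>, although \<open>y1\<close> lies
      in a later large arc than \<open>z\<close>.\<close>
    case 2
    have "x < x1"
      using level_fst_less_snd[OF 2] lev level_mono[of x1 x] by (metis not_le)
    moreover have "x1 \<noteq> z"
      using ends_disjoint[OF e1 2] fst_less_snd[OF 2] by auto
    ultimately have "y1 < z"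
      using nested[OF 2 e1] z by simp
    then show thesis
      using level_mono[of y1 z] level_fst_less_snd[OF e1] lev by simp
  qed
qed

text \<open>Going back one block length stays between two fine ends of the group, hence at the same
  level, and lowers the block number by one. Were \<open>z\<close> matched,
  \<open>end_in_span\<close> would put it in the same group, where \<open>parity\<close> rules this
  out.\<close>

lemma late_shift:
  assumes "(x, y) \<in> late"
  defines "z \<equiv> x - s ^ Suc (level s x)"
  shows "level s z = level s x" "z + s ^ Suc (level s x) = x" "z \<notin> ends"
proof -
  let ?q = "s ^ Suc (level s x)"
  have e: "(x, y) \<in> E" and "\<exists>e'\<in>E. group e' = group (x, y) \<and> fst e' + ?q \<le> x"
    using assms(1) by (simp_all add: late_def)
  then obtain x0 y0 where e0: "(x0, y0) \<in> E"
    and grp: "group (x0, y0) = group (x, y)" and le: "x0 + ?q \<le> x"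
    by force
  show x: "z + ?q = x"
    using le by (simp add: z_def)
  have z: "x0 \<le> z" "z \<le> x"
    using le by (auto simp: z_def)
  show lev: "level s z = level s x"
    using level_mono[OF z(1)] level_mono[OF z(2)] grp by (auto simp: group_def)
  show "z \<notin> ends"
  proof
    assume "z \<in> ends"
    then obtain y' where e': "(z, y') \<in> E" and grp': "group (z, y') = group (x0, y0)"
      using end_in_span[OF e0 e grp z] by blast
    have "even (block s z) = even (block s x)"
      using parity[OF e' e] grp grp' by (simp add: group_def)
    moreover have "block s x = (z + ?q) div ?q"
      by (simp only: x block_def)
    then have "block s x = Suc (block s z)"
      using s_ge_2 by (simp add: block_def lev del: power_Suc)
    ultimately show False by simp
  qed
qed

text \<open>Besides the \<open>2 * card E\<close> ends, each late edge claims its own unmatched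
  bead, namely its shifted fine end.\<close>

lemma card_late: "2 * card E + card late \<le> 2 * s ^ (s + 1)"
proof -
  let ?f = "\<lambda>(x, y). x - s ^ Suc (level s x)"
  have "inj_on ?f late"
  proof (rule inj_onI)
    fix e e' assume late: "e \<in> late" "e' \<in> late" and eq: "?f e = ?f e'"
    obtain x y x' y' where e: "e = (x, y)" "e' = (x', y')" by fastforce
    have xy: "(x, y) \<in> late" "(x', y') \<in> late"
      using late e by simp_all
    have z: "x - s ^ Suc (level s x) = x' - s ^ Suc (level s x')"
      using eq e by simp
    \<comment> \<open>The shift preserves the level, so both fine ends were moved by the same
      distance.\<close>
    have "level s x = level s x'"
      using late_shift(1)[OF xy(1)] late_shift(1)[OF xy(2)] z by metis
    then have "x = x'"
      using late_shift(2)[OF xy(1)] late_shift(2)[OF xy(2)] z by metis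
    then show "e = e'"
      using xy e ends_disjoint[of x y x' y'] by (simp add: late_def)
  qed
  then have "card late = card (?f ` late)"
    by (simp add: card_image)
  also have "\<dots> \<le> card ({..<2 * s ^ (s + 1)} - ends)"
  proof (rule card_mono)
    show "?f ` late \<subseteq> {..<2 * s ^ (s + 1)} - ends"
    proof clarify
      fix x y assume "(x, y) \<in> late"
      moreover from this have "x < 2 * s ^ (s + 1)"
        by (intro fst_bounded[of x y]) (simp add: late_def)
      ultimately show "x - s ^ Suc (level s x) \<in> {..<2 * s ^ (s + 1)} - ends"
        using late_shift(3)[of x y] by (simp add: less_imp_diff_less del: power_Suc)
    qed
  qed simp
  also have "\<dots> = 2 * s ^ (s + 1) - 2 * card E"
    using ends_bounded by (subst card_Diff_subset) (auto simp: card_ends intro: finite_subset)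
  finally show ?thesis
    \<comment> \<open>This bounds \<open>2 * card E\<close> by the number of beads, so the
      subtraction on naturals is not truncated.\<close>
    using card_mono[OF _ ends_bounded] by (simp add: card_ends)
qed

section \<open>Counting the edges that are not late\<close>

text \<open>The edge with the least fine end \<open>a\<close> makes every edge of its group starting
  at \<open>a + s ^ Suc i\<close> or beyond late, so the fine ends fit in one window of that
  length.\<close>

lemma card_not_late_group:
  "card {e \<in> E - late. group e = (i, j, k)} \<le> s ^ Suc i" (is "card ?F \<le> _")
proof (cases "?F = {}")
  case False
  let ?X = "fst ` ?F"
  define a where "a = Min ?X"
  have fin: "finite ?X"
    using finite_E by simp
  then have "a \<in> ?X"
    unfolding a_def using False by (intro Min_in) auto
  then obtain e0 where e0: "e0 \<in> E" "group e0 = (i, j, k)" "fst e0 = a"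
    by force
  have "?X \<subseteq> {a..<a + s ^ Suc i}"
  proof clarify
    fix x y assume e: "(x, y) \<in> E" "(x, y) \<notin> late" "group (x, y) = (i, j, k)"
    then have "a \<le> x"
      unfolding a_def using fin by (intro Min_le) force+
    moreover have "\<not> a + s ^ Suc i \<le> x"
      using e e0 by (auto simp: late_def group_def)
    ultimately show "fst (x, y) \<in> {a..<a + s ^ Suc i}"
      by simp
  qed
  then have "card ?X \<le> card {a..<a + s ^ Suc i}"
    by (intro card_mono) auto
  moreover have "inj_on fst ?F"
    using inj_fst by (rule inj_on_subset) auto
  ultimately show ?thesis
    by (simp add: card_image)
next
  case True
  show ?thesis unfolding True by simp
qed

text \<open>Bounds the non-late edges at one coarse block of level \<open>j\<close>, summed over all
  finer levels.\<close>

lemma sum_power_le: "(\<Sum>i<j. s ^ Suc i) \<le> 2 * s ^ j"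
proof (induction j)
  case (Suc j)
  have "2 * s ^ j \<le> s ^ Suc j"
    using s_ge_2 by simp
  then show ?case
    using Suc by (simp del: power_Suc)
qed simp

text \<open>Here \<open>t\<close> is the number of blocks in a large arc; the lemma limits how many
  groups share a coarse level.\<close>

lemma block_range:
  assumes "level s y < s"
  defines "t \<equiv> 2 * s ^ (s - Suc (level s y))"
  shows "block s y \<in> {level s y * t..<Suc (level s y) * t}"
proof -
  have "2 * s ^ s = s ^ Suc (level s y) * t"
    using assms(1) unfolding t_def by (simp del: power_Suc flip: power_add)
  then have "level s y = y div (s ^ Suc (level s y) * t)"
    by (metis level_def)
  then have "level s y = block s y div t"
    by (simp only: block_def div_mult2_eq)
  then have "level s y * t + block s y mod t = block s y"
    by simp
  moreover have "block s y mod t < t"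
    using s_ge_2 by (simp add: t_def)
  ultimately show ?thesis
    unfolding atLeastLessThan_iff mult_Suc by linarith
qed

text \<open>Level \<open>j\<close> has \<open>2 * s ^ (s - Suc j)\<close> coarse blocks with at most
  \<open>2 * s ^ j\<close> non-late edges each. The product \<open>4 * s ^ (s - 1)\<close> does not
  depend on \<open>j\<close>, and there are \<open>s\<close> levels.\<close>

lemma card_not_late: "card (E - late) \<le> 4 * s ^ s"
proof -
  let ?t = "\<lambda>j. 2 * s ^ (s - Suc j)"
  let ?K = "\<lambda>j. {j * ?t j..<Suc j * ?t j}"
  let ?F = "\<lambda>i j k. {e \<in> E - late. group e = (i, j, k)}"
  have "E - late \<subseteq> (\<Union>j<s. \<Union>i<j. \<Union>k\<in>?K j. ?F i j k)"
  proof clarify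
    fix x y assume e: "(x, y) \<in> E" "(x, y) \<notin> late"
    have "level s y < s"
      using bounded[OF e(1)] by (rule level_less)
    then show "(x, y) \<in> (\<Union>j<s. \<Union>i<j. \<Union>k\<in>?K j. ?F i j k)"
      using e level_fst_less_snd[OF e(1)] block_range[of y]
      by (auto simp: group_def)
  qed
  then have "card (E - late) \<le> card (\<Union>j<s. \<Union>i<j. \<Union>k\<in>?K j. ?F i j k)"
    using finite_E by (intro card_mono) auto
  also have "\<dots> \<le> (\<Sum>j<s. \<Sum>i<j. \<Sum>k\<in>?K j. card (?F i j k))"
    by (intro order.trans[OF card_UN_le] sum_mono) auto
  also have "\<dots> \<le> (\<Sum>j<s. \<Sum>i<j. \<Sum>k\<in>?K j. s ^ Suc i)"
    by (intro sum_mono card_not_late_group)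
  also have "\<dots> = (\<Sum>j<s. ?t j * (\<Sum>i<j. s ^ Suc i))"
    by (simp add: sum_distrib_left)
  also have "\<dots> \<le> (\<Sum>j<s. ?t j * (2 * s ^ j))"
    by (intro sum_mono mult_left_mono sum_power_le) simp
  also have "\<dots> = (\<Sum>j<s. 4 * s ^ (s - 1))"
    by (intro sum.cong) (auto simp flip: power_add)
  also have "\<dots> = 4 * s ^ s"
    using s_ge_2 by (simp add: power_eq_if)
  finally show ?thesis .
qed

lemma card_edges_le: "3 * card E \<le> 2 * s ^ (s + 1) + 4 * s ^ s"
proof -
  have "card E = card late + card (E - late)"
    using finite_E card_Diff_subset[of late E] card_mono[of E late]
    by (auto simp: late_def intro: finite_subset)
  then show ?thesis
    using card_late card_not_late by linarith
qed

end

section \<open>Edges within a large arc\<close>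

text \<open>An arc that does not wrap past the last position is an interval; otherwise its
  complement is one. Either way two cut points \<open>p\<close> and \<open>q\<close> describe
  it.\<close>

lemma contiguous_arc_interval:
  assumes "contiguous_arc N A"
  obtains p q where
    "(\<forall>z<length N. z \<in> A \<longleftrightarrow> p \<le> z \<and> z < q) \<or> (\<forall>z<length N. z \<notin> A \<longleftrightarrow> p \<le> z \<and> z < q)"
proof -
  let ?n = "length N"
  obtain i0 l where l: "0 < l" "l \<le> ?n" and A: "A = (\<lambda>k. (i0 + k) mod ?n) ` {..<l}"
    using assms by (auto simp: contiguous_arc_def)
  \<comment> \<open>\<open>contiguous_arc\<close> admits any natural number as start; after
    reduction the arc wraps at most once.\<close>
  define i where "i = i0 mod ?n"
  have i: "i < ?n"
    using l unfolding i_def by (intro mod_less_divisor) linarith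
  have A: "A = (\<lambda>k. (i + k) mod ?n) ` {..<l}"
    unfolding A i_def by (simp add: mod_add_left_eq)
  have mem: "z \<in> A \<longleftrightarrow> i \<le> z \<and> z < i + l \<or> z + ?n < i + l" if "z < ?n" for z
  proof
    assume "z \<in> A"
    then obtain k where "k < l" "z = (i + k) mod ?n"
      by (auto simp: A)
    then show "i \<le> z \<and> z < i + l \<or> z + ?n < i + l"
      using i l by (cases "i + k < ?n") (auto simp: mod_if)
  next
    assume "i \<le> z \<and> z < i + l \<or> z + ?n < i + l"
    then show "z \<in> A"
    proof
      assume "i \<le> z \<and> z < i + l"
      then show ?thesis
        unfolding A using that by (intro image_eqI[of _ _ "z - i"]) auto
    next
      assume "z + ?n < i + l"
      then show ?thesis
        unfolding A using that i by (intro image_eqI[of _ _ "z + ?n - i"]) auto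
    qed
  qed
  show thesis
  proof (cases "i + l \<le> ?n")
    case True
    then show thesis
      using mem by (intro that[of i "i + l"]) auto
  next
    case False
    then show thesis
      using mem l by (intro that[of "i + l - ?n" i]) auto
  qed
qed

lemma level_separates:
  assumes "level s a = level s b" "a < p" "p \<le> b"
  shows "level s a = level s p"
  using assms div_le_mono[of a p "2 * s ^ s"] div_le_mono[of p b "2 * s ^ s"]
  by (simp add: level_def)

text \<open>The secant separates the ends of each edge, so \<open>p\<close> or \<open>q\<close> lies
  between them and both ends share its level. Disjoint edges have distinct least beads, and the two
  levels contain at most \<open>4 * s ^ s\<close> positions.\<close>

lemma card_same_level:
  assumes s: "0 < s" and M: "matching N M"
    and sec: "secant N A\<^sub>1 A\<^sub>2" and resp: "secant_respecting A\<^sub>1 A\<^sub>2 M"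
  shows "card {e \<in> M. \<forall>a\<in>e. \<forall>b\<in>e. level s a = level s b} \<le> 4 * s ^ s" (is "card ?B \<le> _")
proof -
  let ?w = "2 * s ^ s"
  obtain p q where pq: "(\<forall>z<length N. z \<in> A\<^sub>1 \<longleftrightarrow> p \<le> z \<and> z < q) \<or>
      (\<forall>z<length N. z \<notin> A\<^sub>1 \<longleftrightarrow> p \<le> z \<and> z < q)"
    using sec contiguous_arc_interval unfolding secant_def by metis
  define C where "C = {z. level s z = level s p} \<union> {z. level s z = level s q}"
  have arc: "{z. level s z = m} \<subseteq> {m * ?w..<m * ?w + ?w}" for m
  proof clarify
    fix z
    have "z mod ?w < ?w"
      using s by simp
    then show "z \<in> {level s z * ?w..<level s z * ?w + ?w}"
      using div_mult_mod_eq[of z ?w] unfolding level_def atLeastLessThan_iff by linarith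
  qed
  have fin: "finite C"
    unfolding C_def using finite_subset[OF arc] by simp
  have card_C: "card C \<le> 4 * s ^ s"
    unfolding C_def using card_mono[OF _ arc[of "level s p"]] card_mono[OF _ arc[of "level s q"]]
    by (intro order.trans[OF card_Un_le]) simp
  have mem: "Min e \<in> C \<and> Min e \<in> e" if e: "e \<in> ?B" for e
  proof -
    obtain a b where ab: "a \<in> A\<^sub>1" "b \<in> A\<^sub>2" "e = {a, b}"
      using e resp by (auto simp: secant_respecting_def)
    have "a < length N" "b < length N" "b \<notin> A\<^sub>1"
      using ab sec by (auto simp: secant_def beads_def)
    then have "(p \<le> a \<and> a < q) \<noteq> (p \<le> b \<and> b < q)"
      using pq ab by auto
    moreover have lev: "level s a = level s b"
      using e ab by blast
    ultimately have "level s a = level s p \<or> level s a = level s q"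
      using level_separates[of s a b p] level_separates[of s a b q]
        level_separates[of s b a p] level_separates[of s b a q] by linarith
    then have "a \<in> C" "b \<in> C"
      using lev by (auto simp: C_def)
    then show ?thesis
      using ab by (auto simp: min_def)
  qed
  have "inj_on Min ?B"
  proof (rule inj_onI)
    fix e e' assume e: "e \<in> ?B" "e' \<in> ?B" and eq: "Min e = Min e'"
    have "e \<inter> e' \<noteq> {}"
      using mem[OF e(1)] mem[OF e(2)] unfolding eq by blast
    moreover have "e \<in> M" "e' \<in> M" "disjoint M"
      using e M by (simp_all add: matching_def)
    ultimately show "e = e'"
      using disjointD by blast
  qed
  then have "card ?B \<le> card C"
    using mem fin by (intro card_inj_on_le[of Min]) blast+
  then show ?thesis
    using card_C by simp
qed

section \<open>Proper matchings\<close>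

text \<open>The constant is \<open>16 = 3 * 4 + 4\<close>: three times the bound on edges within a
  large arc, plus the excess in \<open>card_edges_le\<close>.\<close>

lemma card_proper_matching_le:
  assumes s: "2 \<le> s" and M: "model_matching m (L_necklace c s) M" "proper (L_necklace c s) M"
  shows "3 * card M \<le> 2 * s ^ (s + 1) + 16 * s ^ s"
proof -
  let ?N = "L_necklace c s"
  let ?B = "{e \<in> M. \<forall>a\<in>e. \<forall>b\<in>e. level s a = level s b}"
  define E where "E = {(x, y). {x, y} \<in> M \<and> level s x < level s y}"
  have match: "matching ?N M"
    using M by (simp add: model_matching_def)
  have cross: "cross_free ?N M"
    using M by (simp add: proper_def)
  have less: "x < y" if "(x, y) \<in> E" for x y
    using that div_le_mono[of y x "2 * s ^ s"] by (force simp: E_def level_def)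
  have bound: "x < 2 * s ^ (s + 1)" if "e \<in> M" "x \<in> e" for x e
    using that match length_L_necklace[of c s] by (auto simp: matching_def beads_def)
  interpret fine_coarse_edges s E
  proof
    show disj: "(x, y) = (x', y')"
      if "(x, y) \<in> E" "(x', y') \<in> E" "{x, y} \<inter> {x', y'} \<noteq> {}" for x y x' y'
    proof -
      have "{x, y} = {x', y'}"
        using that match disjointD[of M "{x, y}" "{x', y'}"] by (auto simp: matching_def E_def)
      then show ?thesis
        using less[OF that(1)] less[OF that(2)] by (auto simp: doubleton_eq_iff)
    qed
    show "y' < y" if e: "(x, y) \<in> E" and e': "(x', y') \<in> E" and "x < x'" "x' < y" for x y x' y'
    proof -
      have "{x, y} \<noteq> {x', y'}"
        using that less[OF e] less[OF e'] by (auto simp: doubleton_eq_iff)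
      moreover have "{x, y} \<in> M" "{x', y'} \<in> M"
        using e e' by (auto simp: E_def)
      \<comment> \<open>Since \<open>x'\<close> lies in the arc from \<open>x\<close> to
        \<open>y\<close>, cross-freeness puts \<open>y'\<close> there too.\<close>
      ultimately show ?thesis
        using cross that less[OF e] unfolding cross_free_def arc_between_def
        by (smt (verit) disjoint_iff greaterThanLessThan_iff insert_subset insertI1)
    qed
    show "even (block s x) = even (block s x')"
      if "(x, y) \<in> E" "(x', y') \<in> E" and par: "even (block s y) = even (block s y')" for x y x' y'
    proof -
      have "pair_allowed m (?N ! x) (?N ! y)" "pair_allowed m (?N ! x') (?N ! y')"
        using that M by (auto simp: E_def model_matching_def)
      moreover have "x < 2 * s ^ (s + 1)" "y < 2 * s ^ (s + 1)"
          "x' < 2 * s ^ (s + 1)" "y' < 2 * s ^ (s + 1)"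
        using that bound by (auto simp: E_def)
      ultimately show ?thesis
        using par by (cases m; cases c) (auto simp: nth_L_necklace split: if_splits)
    qed
  qed (use s bound in \<open>auto simp: E_def\<close>)
  have fin: "finite M"
    using match by (auto simp: matching_def beads_def intro: finite_subset[of _ "Pow {..<length ?N}"])
  have "M \<subseteq> ?B \<union> (\<lambda>(x, y). {x, y}) ` E"
  proof
    fix e assume e: "e \<in> M"
    then obtain a b where ab: "e = {a, b}"
      using match by (auto simp: matching_def card_2_iff)
    consider "level s a = level s b" | "level s a < level s b" | "level s b < level s a"
      by linarith
    then show "e \<in> ?B \<union> (\<lambda>(x, y). {x, y}) ` E"
    proof cases
      case 1
      then show ?thesis using e ab by auto
    next
      case 2
      then show ?thesis
        using e ab by (intro UnI2 image_eqI[of _ _ "(a, b)"]) (simp_all add: E_def)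
    next
      case 3
      moreover have "e = {b, a}" using ab by blast
      ultimately show ?thesis
        using e by (intro UnI2 image_eqI[of _ _ "(b, a)"]) (simp_all add: E_def)
    qed
  qed
  then have "card M \<le> card (?B \<union> (\<lambda>(x, y). {x, y}) ` E)"
    using fin finite_E by (intro card_mono) auto
  also have "\<dots> \<le> card ?B + card E"
    by (rule order.trans[OF card_Un_le]) (simp add: card_image_le finite_E)
  also have "card ?B \<le> 4 * s ^ s"
    using s M match by (auto simp: proper_def intro: card_same_level)
  finally show ?thesis
    using card_edges_le by simp
qed

section \<open>The maximum and its asymptotics\<close>

lemma max_proper_le:
  assumes s: "2 \<le> s"
  shows "real (max_proper m (L_necklace c s)) \<le> 2 * real (s ^ (s + 1)) / 3 + 16 / 3 * real (s ^ s)"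
proof -
  let ?S = "{card M | M. model_matching m (L_necklace c s) M \<and> proper (L_necklace c s) M}"
  have "2 \<le> length (L_necklace c s)"
    using s by (simp add: length_L_necklace)
  then have "max_proper m (L_necklace c s) \<in> ?S"
    unfolding max_proper_def by (intro Max_in finite_proper_sizes proper_sizes_nonempty)
  then have "3 * max_proper m (L_necklace c s) \<le> 2 * s ^ (s + 1) + 16 * s ^ s"
    using card_proper_matching_le[OF s] by auto
  then have "real (3 * max_proper m (L_necklace c s)) \<le> real (2 * s ^ (s + 1) + 16 * s ^ s)"
    by (rule of_nat_mono)
  then show ?thesis
    by simp
qed

theorem theorem7:
  "\<exists>err :: nat \<Rightarrow> real.
     err \<in> o(\<lambda>s. real (s ^ (s + 1))) \<and>
     (\<forall>s\<ge>2. \<forall>c.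
        real (max_proper Heterogeneous (L_necklace c s)) \<le> 2 * real (s ^ (s + 1)) / 3 + err s \<and>
        real (max_proper Homogeneous (L_necklace c s)) \<le> 2 * real (s ^ (s + 1)) / 3 + err s)"
proof (intro exI[of _ "\<lambda>s. 16 / 3 * real (s ^ s)"] conjI allI impI max_proper_le)
  \<comment> \<open>The error term divided by \<open>s ^ (s + 1)\<close> is
    \<open>16 / 3 / s\<close>.\<close>
  have "(\<lambda>s. 16 / 3 / real s) \<longlonglongrightarrow> 0"
    by (rule lim_const_over_n)
  moreover have "eventually (\<lambda>s. 16 / 3 / real s = 16 / 3 * real (s ^ s) / real (s ^ (s + 1))) sequentially"
    using eventually_gt_at_top[of 0] by eventually_elim simp
  ultimately have "(\<lambda>s. 16 / 3 * real (s ^ s) / real (s ^ (s + 1))) \<longlonglongrightarrow> 0"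
    by (rule Lim_transform_eventually)
  moreover have "eventually (\<lambda>s. real (s ^ (s + 1)) \<noteq> 0) sequentially"
    using eventually_gt_at_top[of 0] by eventually_elim simp
  ultimately show "(\<lambda>s. 16 / 3 * real (s ^ s)) \<in> o(\<lambda>s. real (s ^ (s + 1)))"
    by (intro smalloI_tendsto)
qed

end
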